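(* For $0<c<1$ and $n\ge 1$, consider the class of distributions \[ \mathcal{P}^n_{c} = \left\{P^n_{\kappa, \Delta, \sigma}: \ \Delta = \min \left\{\left\lfloor c\,\frac{\log(n)}{\kappa^2/\sigma^2}\right\rfloor, \left\lfloor \frac{n}{4} \right\rfloor\right\} \right\}, \] where $P^n_{\kappa,\Delta,\sigma}$ denotes the joint distribution of a time series $(Y_1,\dots,Y_n)$ satisfying the change point model (see context) with parameters $\kappa,\Delta,\sigma$. Then for every $0<c<1$ there exists $n(c)$, depending on $c$, such that for all $n$ larger than $n(c)$, \[ \inf_{\hat{\eta}} \ \sup_{P \in \mathcal{P}^n_c} \mathbb{E}_P\bigl( H(\hat{\eta}, \eta(P) ) \bigr) \ \geq\ \frac{n}{8}, \] where the infimum is over all estimators $\hat{\eta} = \{ \hat{\eta}_k\}_{k=1}^{\hat{K}}\subset\{1,\dots,n\}$ of the change point locations (measurable functions of $Y_1,\dots,Y_n$), $\eta(P)$ is the set of locations of the change points of $P$, and $H$ is the Hausdorff distance.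
   Context: Change point model with parameters $\kappa,\Delta,\sigma>0$: $Y_1,\dots,Y_n$ are independent real sub-Gaussian random variables with continuous densities, $\mathbb{E}(Y_i)=f_i$ and $\|Y_i-f_i\|_{\psi_2}\le\sigma$ for all $i$, where $\|X\|_{\psi_2}=\sup_{k\ge1}k^{-1/2}\{\mathbb{E}(|X|^k)\}^{1/k}$. There are integers $0=\eta_0<\eta_1<\dots<\eta_K<\eta_{K+1}=n$ with $K\ge1$ (the change points are $\eta_1,\dots,\eta_K$) such that $f_{\eta_k+1}=\dots=f_{\eta_{k+1}}$ for $k=0,\dots,K$; $\min_{1\le k\le K+1}(\eta_k-\eta_{k-1})\ge\Delta>0$; and, with $\kappa_k=|f_{\eta_k+1}-f_{\eta_k}|$, $\min_{1\le k\le K}\kappa_k=\kappa>0$. In the class $\mathcal{P}^n_c$ the parameters $\kappa,\sigma>0$ range over all values. Hausdorff distance of subsets $E_1,E_2$ of $\{1,\dots,n\}$: $H(E_1,E_2)=\max\{\max_{x\in E_1}\min_{y\in E_2}|x-y|,\ \max_{y\in E_2}\min_{x\in E_1}|x-y|\}$ (a minimum over the empty set is $+\infty$). *)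

theory Defs
  imports "HOL-Probability.Probability"
begin

text \<open>The norm is infinite as soon as one of the absolute moments is infinite.\<close>

definition psi2_norm :: "'a measure \<Rightarrow> ('a \<Rightarrow> real) \<Rightarrow> ennreal" where
  "psi2_norm M X = (SUP k\<in>{1::nat..}.
     if integrable M (\<lambda>x. \<bar>X x\<bar> ^ k)
     then ennreal (real k powr (- 1 / 2) * (\<integral>x. \<bar>X x\<bar> ^ k \<partial>M) powr (1 / real k))
     else \<infinity>)"

text \<open>
  \<open>P\<close> is the joint distribution of \<open>(Y\<^sub>1, \<dots>, Y\<^sub>n)\<close> on the product space over \<open>{1..n}\<close>, so
  that \<open>Y\<^sub>i\<close> is the coordinate map \<open>\<lambda>\<omega>. \<omega> i\<close>.
  Only the values \<open>\<eta> 0, \<dots>, \<eta> (K + 1)\<close> and \<open>f 1, \<dots>, f n\<close> matter.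
\<close>

locale change_point_model = prob_space P
  for P :: "(nat \<Rightarrow> real) measure" +
  fixes n :: nat and \<kappa> \<Delta> \<sigma> :: real and f :: "nat \<Rightarrow> real" and K :: nat and \<eta> :: "nat \<Rightarrow> nat"
  assumes sets_P: "sets P = sets (\<Pi>\<^sub>M i\<in>{1..n}. (borel :: real measure))"
    and indep: "indep_vars (\<lambda>_. borel) (\<lambda>i \<omega>. \<omega> i) {1..n}"
    and continuous_density: "\<And>i. i \<in> {1..n} \<Longrightarrow>
      \<exists>g :: real \<Rightarrow> real. continuous_on UNIV g \<and> (\<forall>x. 0 \<le> g x) \<and>
        distributed P lborel (\<lambda>\<omega>. \<omega> i) (\<lambda>x. ennreal (g x))"
    and mean: "\<And>i. i \<in> {1..n} \<Longrightarrow> has_bochner_integral P (\<lambda>\<omega>. \<omega> i) (f i)"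
    and sub_Gaussian: "\<And>i. i \<in> {1..n} \<Longrightarrow> psi2_norm P (\<lambda>\<omega>. \<omega> i - f i) \<le> ennreal \<sigma>"
    and \<sigma>_pos: "0 < \<sigma>"
    and K_ge_1: "1 \<le> K"
    and \<eta>_first: "\<eta> 0 = 0"
    and \<eta>_last: "\<eta> (K + 1) = n"
    and \<eta>_less: "\<And>k. k \<le> K \<Longrightarrow> \<eta> k < \<eta> (k + 1)"
    and f_const: "\<And>k i j. \<lbrakk>k \<le> K; i \<in> {\<eta> k + 1..\<eta> (k + 1)}; j \<in> {\<eta> k + 1..\<eta> (k + 1)}\<rbrakk> \<Longrightarrow> f i = f j"
    and spacing: "\<Delta> \<le> (MIN k\<in>{1..K + 1}. real (\<eta> k) - real (\<eta> (k - 1)))"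
    and \<Delta>_pos: "0 < \<Delta>"
    and jump: "(MIN k\<in>{1..K}. \<bar>f (\<eta> k + 1) - f (\<eta> k)\<bar>) = \<kappa>"
    and \<kappa>_pos: "0 < \<kappa>"

text \<open>The set is determined by \<open>P\<close> alone, see \<open>change_points_eq\<close> below.\<close>

definition change_points :: "nat \<Rightarrow> (nat \<Rightarrow> real) measure \<Rightarrow> nat set" where
  "change_points n P =
     (THE E. \<exists>\<kappa> \<Delta> \<sigma> f K \<eta>. change_point_model P n \<kappa> \<Delta> \<sigma> f K \<eta> \<and> E = \<eta> ` {1..K})"

definition model_class :: "real \<Rightarrow> nat \<Rightarrow> (nat \<Rightarrow> real) measure set" where
  "model_class c n = {P. \<exists>\<kappa> \<Delta> \<sigma> f K \<eta>. change_point_model P n \<kappa> \<Delta> \<sigma> f K \<eta> \<and>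
     \<Delta> = real_of_int (min \<lfloor>c * (ln (real n) / (\<kappa>\<^sup>2 / \<sigma>\<^sup>2))\<rfloor> \<lfloor>real n / 4\<rfloor>)}"

definition estimators :: "nat \<Rightarrow> ((nat \<Rightarrow> real) \<Rightarrow> nat set) set" where
  "estimators n = measurable (\<Pi>\<^sub>M i\<in>{1..n}. (borel :: real measure)) (count_space (Pow {1..n}))"

text \<open>
  In \<^typ>\<open>ennreal\<close> the infimum over the empty set is \<open>\<infinity>\<close> and the supremum is \<open>0\<close>; on finite
  nonempty sets they are minimum and maximum.
\<close>

definition hausdorff_distance :: "nat set \<Rightarrow> nat set \<Rightarrow> ennreal" where
  "hausdorff_distance E\<^sub>1 E\<^sub>2 =
     max (SUP x\<in>E\<^sub>1. INF y\<in>E\<^sub>2. ennreal \<bar>real x - real y\<bar>)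
         (SUP y\<in>E\<^sub>2. INF x\<in>E\<^sub>1. ennreal \<bar>real x - real y\<bar>)"

context change_point_model
begin

lemma \<eta>_mono: "k \<le> l \<Longrightarrow> l \<le> K + 1 \<Longrightarrow> \<eta> k \<le> \<eta> l"
proof (induction l)
  case (Suc l)
  show ?case
  proof (cases "k = Suc l")
    case False
    then have "\<eta> k \<le> \<eta> l" using Suc by auto
    also have "\<eta> l < \<eta> (l + 1)" using Suc.prems by (intro \<eta>_less) auto
    finally show ?thesis by simp
  qed simp
qed simp

lemma \<eta>_interval:
  assumes "i < n" shows "\<exists>k\<le>K. \<eta> k \<le> i \<and> i < \<eta> (k + 1)"
proof -
  define k where "k = (LEAST l. i < \<eta> l)"
  have ex: "i < \<eta> (K + 1)" using assms \<eta>_last by simp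
  have 1: "i < \<eta> k" unfolding k_def using ex by (rule LeastI)
  have 2: "k \<le> K + 1" unfolding k_def using ex by (rule Least_le)
  have "k \<noteq> 0" using 1 \<eta>_first by (metis not_less0)
  then obtain l where l: "k = l + 1" by (cases k) auto
  have "\<not> i < \<eta> l" using not_less_Least[of l "\<lambda>l. i < \<eta> l"] l unfolding k_def[symmetric] by simp
  then show ?thesis using 1 2 l by (intro exI[of _ l]) auto
qed

lemma \<eta>_image: "\<eta> ` {1..K} = {i\<in>{1..<n}. f (i + 1) \<noteq> f i}"
proof (intro set_eqI iffI)
  fix i assume "i \<in> \<eta> ` {1..K}"
  then obtain k where k: "1 \<le> k" "k \<le> K" "i = \<eta> k" by auto
  have "\<kappa> \<le> \<bar>f (\<eta> k + 1) - f (\<eta> k)\<bar>"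
    unfolding jump[symmetric] using k by (intro Min_le) auto
  then have "f (i + 1) \<noteq> f i" using \<kappa>_pos k by auto
  moreover have "0 < i" using \<eta>_less[of 0] \<eta>_mono[of 1 k] k by simp
  moreover have "i < n" using \<eta>_less[of k] \<eta>_mono[of "k + 1" "K + 1"] \<eta>_last k by simp
  ultimately show "i \<in> {i\<in>{1..<n}. f (i + 1) \<noteq> f i}" by simp
next
  fix i assume "i \<in> {i\<in>{1..<n}. f (i + 1) \<noteq> f i}"
  then have i: "1 \<le> i" "i < n" "f (i + 1) \<noteq> f i" by auto
  obtain k where k: "k \<le> K" "\<eta> k \<le> i" "i < \<eta> (k + 1)" using \<eta>_interval i by blast
  have "\<eta> k = i"
  proof (rule ccontr)
    assume "\<eta> k \<noteq> i"
    then have "f (i + 1) = f i" using k by (intro f_const[of k]) auto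
    with i show False by simp
  qed
  moreover have "k \<noteq> 0" using calculation \<eta>_first i by (metis not_one_le_zero)
  ultimately show "i \<in> \<eta> ` {1..K}" using k by auto
qed

end

lemma change_point_model_unique:
  assumes "change_point_model P n \<kappa> \<Delta> \<sigma> f K \<eta>" "change_point_model P n \<kappa>' \<Delta>' \<sigma>' f' K' \<eta>'"
  shows "\<eta> ` {1..K} = \<eta>' ` {1..K'}"
proof -
  interpret a: change_point_model P n \<kappa> \<Delta> \<sigma> f K \<eta> by fact
  interpret b: change_point_model P n \<kappa>' \<Delta>' \<sigma>' f' K' \<eta>' by fact
  have "f i = f' i" if "i \<in> {1..n}" for i
    using a.mean[OF that] b.mean[OF that] by (rule has_bochner_integral_eq)
  then show ?thesis unfolding a.\<eta>_image b.\<eta>_image by auto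
qed

lemma change_points_eq:
  assumes "change_point_model P n \<kappa> \<Delta> \<sigma> f K \<eta>"
  shows "change_points n P = \<eta> ` {1..K}"
  unfolding change_points_def
  using assms change_point_model_unique by (intro the_equality) blast+

end

theory Submission
  imports Defs "HOL-Real_Asymp.Real_Asymp"
begin

text \<open>
  Take \<open>\<sigma> = 1\<close> and \<open>\<kappa>\<^sup>2 = c * ln n\<close>, so that \<open>\<Delta> = 1\<close>, and consider standard Gaussian noise with a
  mean that vanishes except for a spike of height \<open>\<kappa>\<close> at a single position \<open>j\<close>; its change points are
  \<open>j - 1\<close> and \<open>j\<close>. The likelihood ratio with respect to pure noise has variance
  \<open>exp (\<kappa>\<^sup>2) - 1 < n powr c\<close>, and the ratios for different positions are uncorrelated. Since \<open>c < 1\<close>,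
  the uniform mixture of the spikes over about \<open>n / 16\<close> positions is therefore hardly distinguishable
  from pure noise. An estimate cannot be within \<open>3 * n / 8\<close> both of a spike among the first and of a
  spike among the last \<open>n / 16\<close> positions, so under pure noise it is, with probability at least
  \<open>1 / 2\<close>, far from all spikes at one of the two ends. The same then holds with probability at least
  \<open>1 / 3\<close> under one of these spikes, where the risk is thus at least \<open>(3 * n / 8) / 3 = n / 8\<close>.
\<close>

section \<open>Densities of product measures\<close>

text \<open>A measure on a finite product is determined by its values on boxes, and there the
  indicator factorises over the coordinates, so the integral of the product of the
  \<open>g i\<close> splits into one-dimensional integrals.\<close>

lemma PiM_density:
  fixes g :: "'i \<Rightarrow> 'a \<Rightarrow> ennreal"
  assumes "finite I" "product_sigma_finite M" "product_sigma_finite (\<lambda>i. density (M i) (g i))"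
    and g: "\<And>i. i \<in> I \<Longrightarrow> g i \<in> borel_measurable (M i)"
  shows "(\<Pi>\<^sub>M i\<in>I. density (M i) (g i)) = density (Pi\<^sub>M I M) (\<lambda>\<omega>. \<Prod>i\<in>I. g i (\<omega> i))"
proof -
  interpret M: product_sigma_finite M by fact
  interpret D: product_sigma_finite "\<lambda>i. density (M i) (g i)" by fact
  have [measurable]: "(\<lambda>\<omega>. \<Prod>i\<in>I. g i (\<omega> i)) \<in> borel_measurable (Pi\<^sub>M I M)"
    using g by (intro borel_measurable_prod_ennreal measurable_compose[OF measurable_component_singleton]) auto
  show ?thesis
  proof (rule D.PiM_eqI[symmetric])
    show "sets (density (Pi\<^sub>M I M) (\<lambda>\<omega>. \<Prod>i\<in>I. g i (\<omega> i))) = sets (\<Pi>\<^sub>M i\<in>I. density (M i) (g i))"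
      by (simp cong: sets_PiM_cong)
  next
    fix A assume "\<And>i. i \<in> I \<Longrightarrow> A i \<in> sets (density (M i) (g i))"
    then have A: "\<And>i. i \<in> I \<Longrightarrow> A i \<in> sets (M i)" by simp
    have box: "Pi\<^sub>E I A \<in> sets (Pi\<^sub>M I M)"
      using A \<open>finite I\<close> by (intro sets_PiM_I_finite) auto
    have "emeasure (density (Pi\<^sub>M I M) (\<lambda>\<omega>. \<Prod>i\<in>I. g i (\<omega> i))) (Pi\<^sub>E I A) =
        (\<integral>\<^sup>+\<omega>. (\<Prod>i\<in>I. g i (\<omega> i)) * indicator (Pi\<^sub>E I A) \<omega> \<partial>Pi\<^sub>M I M)"
      using box by (simp add: emeasure_density)
    also have "\<dots> = (\<integral>\<^sup>+\<omega>. (\<Prod>i\<in>I. g i (\<omega> i) * indicator (A i) (\<omega> i)) \<partial>Pi\<^sub>M I M)"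
    proof (rule nn_integral_cong)
      fix \<omega> assume "\<omega> \<in> space (Pi\<^sub>M I M)"
      then have "indicator (Pi\<^sub>E I A) \<omega> = (\<Prod>i\<in>I. indicator (A i) (\<omega> i) :: ennreal)"
        using \<open>finite I\<close> by (auto simp: space_PiM PiE_iff indicator_def prod_zero_iff)
      then show "(\<Prod>i\<in>I. g i (\<omega> i)) * indicator (Pi\<^sub>E I A) \<omega> = (\<Prod>i\<in>I. g i (\<omega> i) * indicator (A i) (\<omega> i))"
        by (simp add: prod.distrib)
    qed
    also have "\<dots> = (\<Prod>i\<in>I. \<integral>\<^sup>+x. g i x * indicator (A i) x \<partial>M i)"
      using A g \<open>finite I\<close> by (intro M.product_nn_integral_prod) auto
    also have "\<dots> = (\<Prod>i\<in>I. emeasure (density (M i) (g i)) (A i))"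
      using A g by (intro prod.cong) (auto simp: emeasure_density)
    finally show "emeasure (density (Pi\<^sub>M I M) (\<lambda>\<omega>. \<Prod>i\<in>I. g i (\<omega> i))) (Pi\<^sub>E I A) =
      (\<Prod>i\<in>I. emeasure (density (M i) (g i)) (A i))" .
  qed fact
qed

section \<open>Gaussian laws of unit variance: tilting, moments and the sub-Gaussian norm\<close>

abbreviation gaussian :: "real \<Rightarrow> real measure" where
  "gaussian \<mu> \<equiv> density lborel (\<lambda>x. ennreal (normal_density \<mu> 1 x))"

lemma prob_space_gaussian: "prob_space (gaussian \<mu>)"
  using prob_space_normal_density[of 1 \<mu>] by simp

text \<open>Completing the square: an exponential tilt by \<open>a\<close> shifts the mean by
  \<open>a\<close>. This one identity yields both the likelihood ratio of two Gaussians and the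
  exponential moments.\<close>

lemma normal_density_tilt:
  "normal_density \<mu> 1 x * exp (a * x) = exp (a * \<mu> + a\<^sup>2 / 2) * normal_density (\<mu> + a) 1 x"
  by (simp add: normal_density_def exp_add[symmetric] field_simps power2_eq_square)

lemma gaussian_density: "gaussian \<mu> = density (gaussian 0) (\<lambda>x. ennreal (exp (\<mu> * x - \<mu>\<^sup>2 / 2)))"
proof -
  have "normal_density 0 1 x * exp (\<mu> * x - \<mu>\<^sup>2 / 2) = normal_density \<mu> 1 x" for x
    using normal_density_tilt[of 0 x \<mu>] unfolding exp_diff by simp
  then show ?thesis
    by (simp add: density_density_eq ennreal_mult[symmetric])
qed

lemma gaussian_exp_moment: "has_bochner_integral (gaussian 0) (\<lambda>x. exp (a * x)) (exp (a\<^sup>2 / 2))"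
proof -
  have "has_bochner_integral lborel (\<lambda>x. exp (a\<^sup>2 / 2) * normal_density a 1 x) (exp (a\<^sup>2 / 2) * 1)"
    by (intro has_bochner_integral_mult_right) (auto simp: has_bochner_integral_iff)
  then have "has_bochner_integral lborel (\<lambda>x. normal_density 0 1 x *\<^sub>R exp (a * x)) (exp (a\<^sup>2 / 2))"
    using normal_density_tilt[of 0 _ a] by simp
  then show ?thesis by (intro has_bochner_integral_density) auto
qed

text \<open>The bound is shaped so that its \<open>k\<close>-th root is \<open>sqrt k\<close>, which
  cancels the factor \<open>k powr (- 1 / 2)\<close> in \<open>psi2_norm\<close>. Even and odd
  moments have different closed forms, hence the case split.\<close>

lemma gaussian_abs_moment_le:
  assumes "1 \<le> k"
  shows "(\<integral>x. normal_density \<mu> 1 x * \<bar>x - \<mu>\<bar> ^ k \<partial>lborel) \<le> sqrt (real k) ^ k"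
proof (cases "even k")
  case True
  then obtain m where m: "k = 2 * m" by (auto elim: evenE)
  \<comment> \<open>The quotient (2m)! / m! is a product of \<open>m\<close> factors, each at most
    \<open>2 * m\<close>. The further factor \<open>2 ^ m\<close> in the denominator of the moment
    is simply dropped later.\<close>
  have "fact (2 * m) div fact (2 * m - m) \<le> (2 * m) ^ m" by (rule fact_div_fact_le_pow) simp
  then have "fact (2 * m) div fact m \<le> (2 * m) ^ m" by simp
  moreover have "(fact m :: nat) dvd fact (2 * m)" by (intro fact_dvd) simp
  ultimately have "(fact (2 * m) :: nat) \<le> (2 * m) ^ m * fact m"
    by (metis dvd_div_mult_self mult_le_mono1)
  then have "real (fact (2 * m)) \<le> real ((2 * m) ^ m * fact m)" by (simp only: of_nat_le_iff)
  then have "fact (2 * m) \<le> (2 * real m) ^ m * (fact m)" by simp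
  then have "fact (2 * m) / fact m \<le> (2 * real m) ^ m" by (simp add: field_simps)
  moreover have "fact (2 * m) / (2 ^ m * fact m) \<le> fact (2 * m) / (fact m :: real)"
    by (intro divide_left_mono) (auto simp: mult_le_cancel_right1)
  moreover have "(\<integral>x. normal_density \<mu> 1 x * \<bar>x - \<mu>\<bar> ^ k \<partial>lborel) = fact (2 * m) / (2 ^ m * fact m)"
    using integral_normal_moment_even[of 1 \<mu> m] by (simp add: m power_even_abs)
  moreover have "sqrt (real k) ^ k = (2 * real m) ^ m"
    by (simp add: m power_mult)
  ultimately show ?thesis by linarith
next
  case False
  then obtain m where m: "k = 2 * m + 1" by (auto elim: oddE)
  have "fact m \<le> real m ^ m" using fact_le_power[of m, where 'a = real] by simp
  then have "2 ^ m * fact m \<le> (2 * real m) ^ m" by (simp add: power_mult_distrib)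
  also have "\<dots> \<le> real k ^ m" by (intro power_mono) (auto simp: m)
  also have "\<dots> = sqrt (real k) ^ (2 * m) * 1" by (simp add: power_mult)
  also have "\<dots> \<le> sqrt (real k) ^ (2 * m) * sqrt (real k)"
    by (intro mult_left_mono) (use assms in auto)
  also have "\<dots> = sqrt (real k) ^ k" by (simp add: m)
  finally have *: "2 ^ m * fact m \<le> sqrt (real k) ^ k" .
  have "(\<integral>x. normal_density \<mu> 1 x * \<bar>x - \<mu>\<bar> ^ k \<partial>lborel) = 2 ^ m * fact m * sqrt (2 / pi)"
    using integral_normal_moment_abs_odd[of 1 \<mu> m] by (simp add: m)
  also have "\<dots> \<le> 2 ^ m * fact m * 1"
    using pi_gt3 by (intro mult_left_mono) (auto simp: field_simps)
  finally show ?thesis using * by simp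
qed

text \<open>This is what permits the choice \<open>\<sigma> = 1\<close>: every term of the supremum
  is at most \<open>k powr (- 1 / 2) * k powr (1 / 2) = 1\<close>.\<close>

lemma psi2_norm_gaussian_le:
  assumes X: "distributed M lborel X (\<lambda>x. ennreal (normal_density \<mu> 1 x))"
  shows "psi2_norm M (\<lambda>\<omega>. X \<omega> - \<mu>) \<le> 1"
  unfolding psi2_norm_def
proof (intro SUP_least)
  fix k :: nat assume "k \<in> {1..}"
  then have k: "1 \<le> k" by simp
  have int: "integrable M (\<lambda>\<omega>. \<bar>X \<omega> - \<mu>\<bar> ^ k)"
    using distributed_integrable[OF X, of "\<lambda>x. \<bar>x - \<mu>\<bar> ^ k"] integrable_normal_moment_abs[of 1 \<mu> k]
    by simp
  define a where "a = (\<integral>\<omega>. \<bar>X \<omega> - \<mu>\<bar> ^ k \<partial>M)"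
  have "a = (\<integral>x. normal_density \<mu> 1 x * \<bar>x - \<mu>\<bar> ^ k \<partial>lborel)"
    using distributed_integral[OF X, of "\<lambda>x. \<bar>x - \<mu>\<bar> ^ k"] by (simp add: a_def)
  with gaussian_abs_moment_le[OF k, of \<mu>] have a: "a \<le> sqrt (real k) ^ k" by simp
  have "a powr (1 / real k) \<le> (sqrt (real k) ^ k) powr (1 / real k)"
    using a by (intro powr_mono2) (auto simp: a_def)
  also have "\<dots> = real k powr (1 / 2)"
    using k by (simp add: powr_realpow[symmetric] powr_powr powr_half_sqrt)
  finally have "real k powr (- 1 / 2) * a powr (1 / real k) \<le> real k powr (- 1 / 2) * real k powr (1 / 2)"
    by (intro mult_left_mono) auto
  also have "\<dots> = 1" using k by (simp add: powr_add[symmetric])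
  finally show "(if integrable M (\<lambda>\<omega>. \<bar>X \<omega> - \<mu>\<bar> ^ k)
      then ennreal (real k powr (- 1 / 2) * (\<integral>\<omega>. \<bar>X \<omega> - \<mu>\<bar> ^ k \<partial>M) powr (1 / real k)) else \<infinity>) \<le> 1"
    using int unfolding a_def by (simp add: ennreal_le_1)
qed

section \<open>Gaussian series with a spike in the mean, as members of the model class\<close>

definition gaussian_series :: "nat \<Rightarrow> (nat \<Rightarrow> real) \<Rightarrow> (nat \<Rightarrow> real) measure" where
  "gaussian_series n f = (\<Pi>\<^sub>M i\<in>{1..n}. gaussian (f i))"

definition spike :: "real \<Rightarrow> nat \<Rightarrow> nat \<Rightarrow> real" where
  "spike \<kappa> j = (\<lambda>i. if i = j then \<kappa> else 0)"

lemma sets_gaussian_series [measurable_cong]: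
  "sets (gaussian_series n f) = sets (\<Pi>\<^sub>M i\<in>{1..n}. (borel :: real measure))"
  unfolding gaussian_series_def by (intro sets_PiM_cong) auto

lemma space_gaussian_series: "space (gaussian_series n f) = space (\<Pi>\<^sub>M i\<in>{1..n}. (borel :: real measure))"
  by (intro sets_eq_imp_space_eq sets_gaussian_series)

lemma prob_space_gaussian_series: "prob_space (gaussian_series n f)"
  unfolding gaussian_series_def by (intro prob_space_PiM prob_space_gaussian)

lemma measurable_gaussian_series_component:
  "i \<in> {1..n} \<Longrightarrow> (\<lambda>\<omega>. \<omega> i) \<in> borel_measurable (gaussian_series n f)"
  by measurable

lemma distr_gaussian_series_component:
  assumes "i \<in> {1..n}"
  shows "distr (gaussian_series n f) borel (\<lambda>\<omega>. \<omega> i) = gaussian (f i)"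
proof -
  \<comment> \<open>\<open>distr\<close> depends on its target only through the sigma-algebra; the
    target is changed to the factor measure to match the library rule on components.\<close>
  have "distr (gaussian_series n f) borel (\<lambda>\<omega>. \<omega> i) = distr (gaussian_series n f) (gaussian (f i)) (\<lambda>\<omega>. \<omega> i)"
    by (intro distr_cong) auto
  also have "\<dots> = gaussian (f i)"
    unfolding gaussian_series_def using assms
    by (intro distr_PiM_component) (auto intro: prob_space_gaussian)
  finally show ?thesis .
qed

lemma distributed_gaussian_series_component:
  assumes "i \<in> {1..n}"
  shows "distributed (gaussian_series n f) lborel (\<lambda>\<omega>. \<omega> i) (\<lambda>x. ennreal (normal_density (f i) 1 x))"
proof -
  have "distr (gaussian_series n f) lborel (\<lambda>\<omega>. \<omega> i) = distr (gaussian_series n f) borel (\<lambda>\<omega>. \<omega> i)"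
    by (intro distr_cong) auto
  then show ?thesis
    unfolding distributed_def
    using distr_gaussian_series_component[OF assms] measurable_gaussian_series_component[OF assms] by simp
qed

text \<open>Independence holds because the joint law of the coordinates is the product of their
  marginals; \<open>1 \<le> n\<close> makes the index set nonempty.\<close>

lemma indep_vars_gaussian_series:
  assumes "1 \<le> n"
  shows "prob_space.indep_vars (gaussian_series n f) (\<lambda>_. borel) (\<lambda>i \<omega>. \<omega> i) {1..n}"
proof -
  interpret prob_space "gaussian_series n f" by (rule prob_space_gaussian_series)
  \<comment> \<open>Points of the product space are extensional, so restricting them to
    \<open>{1..n}\<close> changes nothing.\<close>
  have "distr (gaussian_series n f) (\<Pi>\<^sub>M i\<in>{1..n}. borel) (\<lambda>\<omega>. \<lambda>i\<in>{1..n}. \<omega> i) =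
      distr (gaussian_series n f) (gaussian_series n f) (\<lambda>\<omega>. \<omega>)"
    by (intro distr_cong)
       (auto simp: sets_gaussian_series space_gaussian_series space_PiM PiE_def extensional_restrict)
  also have "\<dots> = gaussian_series n f" by (rule distr_id)
  also have "\<dots> = (\<Pi>\<^sub>M i\<in>{1..n}. gaussian (f i))" by (rule gaussian_series_def)
  also have "\<dots> = (\<Pi>\<^sub>M i\<in>{1..n}. distr (gaussian_series n f) borel (\<lambda>\<omega>. \<omega> i))"
    by (intro PiM_cong refl distr_gaussian_series_component[symmetric])
  finally show ?thesis
    using assms measurable_gaussian_series_component
    by (subst indep_vars_iff_distr_eq_PiM') auto
qed

text \<open>The middle segment is the single index \<open>j\<close>, which forces spacing 1; the
  jumps are up and down by \<open>\<kappa>\<close>. The bounds on \<open>j\<close> keep the two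
  outer segments nonempty.\<close>

lemma change_point_model_spike:
  assumes j: "2 \<le> j" "j < n" and \<kappa>: "0 < \<kappa>"
  defines "\<eta> \<equiv> \<lambda>k. if k = 0 then 0 else if k = 1 then j - 1 else if k = 2 then j else n"
  shows "change_point_model (gaussian_series n (spike \<kappa> j)) n \<kappa> 1 1 (spike \<kappa> j) 2 \<eta>"
proof -
  interpret prob_space "gaussian_series n (spike \<kappa> j)" by (rule prob_space_gaussian_series)
  have ivl: "{1..2 + 1} = {1, 2, 3 :: nat}" "{1..2} = {1, 2 :: nat}" by auto
  note D = distributed_gaussian_series_component[of _ n "spike \<kappa> j"]
  show ?thesis
  proof
    show "sets (gaussian_series n (spike \<kappa> j)) = sets (\<Pi>\<^sub>M i\<in>{1..n}. (borel :: real measure))"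
      by (rule sets_gaussian_series)
    show "indep_vars (\<lambda>_. borel) (\<lambda>i \<omega>. \<omega> i) {1..n}"
      using j by (intro indep_vars_gaussian_series) simp
    show "\<exists>g :: real \<Rightarrow> real. continuous_on UNIV g \<and> (\<forall>x. 0 \<le> g x) \<and>
        distributed (gaussian_series n (spike \<kappa> j)) lborel (\<lambda>\<omega>. \<omega> i) (\<lambda>x. ennreal (g x))"
      if "i \<in> {1..n}" for i
      by (intro exI[of _ "normal_density (spike \<kappa> j i) 1"] conjI D[OF that])
         (auto simp: normal_density_def intro!: continuous_intros)
    show "has_bochner_integral (gaussian_series n (spike \<kappa> j)) (\<lambda>\<omega>. \<omega> i) (spike \<kappa> j i)"
      if "i \<in> {1..n}" for i
      using distributed_integrable[OF D[OF that], of "\<lambda>x. x"] distributed_integral[OF D[OF that], of "\<lambda>x. x"]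
        integrable_normal_moment_nz_1[of 1 "spike \<kappa> j i"] integral_normal_moment_nz_1[of 1 "spike \<kappa> j i"]
      by (simp add: has_bochner_integral_iff)
    show "psi2_norm (gaussian_series n (spike \<kappa> j)) (\<lambda>\<omega>. \<omega> i - spike \<kappa> j i) \<le> ennreal 1"
      if "i \<in> {1..n}" for i
      using psi2_norm_gaussian_le[OF D[OF that]] by simp
    show "\<eta> k < \<eta> (k + 1)" if "k \<le> 2" for k
      using that j by (auto simp: \<eta>_def)
    show "spike \<kappa> j i = spike \<kappa> j i'"
      if "k \<le> 2" "i \<in> {\<eta> k + 1..\<eta> (k + 1)}" "i' \<in> {\<eta> k + 1..\<eta> (k + 1)}" for k i i'
      using that j by (auto simp: \<eta>_def spike_def split: if_splits)
    show "1 \<le> (MIN k\<in>{1..2 + 1}. real (\<eta> k) - real (\<eta> (k - 1)))"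
      unfolding ivl using j by (auto simp: \<eta>_def)
    show "(MIN k\<in>{1..2}. \<bar>spike \<kappa> j (\<eta> k + 1) - spike \<kappa> j (\<eta> k)\<bar>) = \<kappa>"
      unfolding ivl using j \<kappa> by (auto simp: \<eta>_def spike_def)
  qed (use \<kappa> in \<open>auto simp: \<eta>_def\<close>)
qed

lemma change_points_spike:
  assumes "2 \<le> j" "j < n" "0 < \<kappa>"
  shows "change_points n (gaussian_series n (spike \<kappa> j)) = {j - 1, j}"
proof -
  have "{1..2} = {1, 2 :: nat}" by auto
  then show ?thesis
    using change_points_eq[OF change_point_model_spike[OF assms]] by (simp add: insert_commute)
qed

text \<open>This \<open>\<kappa>\<close> makes the signal-to-noise term exactly 1 before taking the
  floor, and \<open>4 \<le> n\<close> keeps the other term of the minimum at least 1, so the class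
  prescribes precisely the spacing 1 of a spike.\<close>

lemma gaussian_series_spike_in_model_class:
  fixes n :: nat and c :: real
  defines "\<kappa> \<equiv> sqrt (c * ln (real n))"
  assumes "2 \<le> j" "j < n" "0 < c" "4 \<le> n"
  shows "gaussian_series n (spike \<kappa> j) \<in> model_class c n"
proof -
  have pos: "0 < c * ln (real n)" using assms by simp
  then have "c \<noteq> 0" "ln (real n) \<noteq> 0" by auto
  with pos have eq: "c * (ln (real n) / (\<kappa>\<^sup>2 / 1\<^sup>2)) = 1"
    by (simp add: \<kappa>_def)
  have "1 \<le> \<lfloor>real n / 4\<rfloor>" using assms by (simp add: le_floor_iff)
  then have "1 = real_of_int (min \<lfloor>c * (ln (real n) / (\<kappa>\<^sup>2 / 1\<^sup>2))\<rfloor> \<lfloor>real n / 4\<rfloor>)"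
    unfolding eq by simp
  moreover have "0 < \<kappa>" using pos by (simp add: \<kappa>_def)
  ultimately show ?thesis
    unfolding model_class_def using change_point_model_spike[OF assms(2,3)] by blast
qed

section \<open>Likelihood ratios of the spikes and their covariances under pure noise\<close>

text \<open>Coordinates other than \<open>j\<close> have the same law in both series and contribute
  the factor 1 to the likelihood ratio.\<close>

lemma gaussian_series_spike_density:
  assumes "j \<in> {1..n}"
  shows "gaussian_series n (spike \<kappa> j) =
    density (gaussian_series n (\<lambda>_. 0)) (\<lambda>\<omega>. ennreal (exp (\<kappa> * \<omega> j - \<kappa>\<^sup>2 / 2)))"
proof -
  let ?g = "\<lambda>i x. ennreal (exp (spike \<kappa> j i * x - (spike \<kappa> j i)\<^sup>2 / 2))"
  have psf: "product_sigma_finite (\<lambda>i. gaussian (f i))" for f :: "nat \<Rightarrow> real"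
    by unfold_locales (rule prob_space_imp_sigma_finite[OF prob_space_gaussian, THEN sigma_finite_measure.sigma_finite_countable])
  have "gaussian_series n (spike \<kappa> j) = (\<Pi>\<^sub>M i\<in>{1..n}. density (gaussian 0) (?g i))"
    unfolding gaussian_series_def by (simp flip: gaussian_density)
  also have "\<dots> = density (\<Pi>\<^sub>M i\<in>{1..n}. gaussian 0) (\<lambda>\<omega>. \<Prod>i\<in>{1..n}. ?g i (\<omega> i))"
    using psf[of "\<lambda>_. 0"] psf[of "spike \<kappa> j"]
    by (intro PiM_density) (simp_all flip: gaussian_density)
  also have "(\<lambda>\<omega>. \<Prod>i\<in>{1..n}. ?g i (\<omega> i)) = (\<lambda>\<omega>. ennreal (exp (\<kappa> * \<omega> j - \<kappa>\<^sup>2 / 2)))"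
  proof
    fix \<omega> :: "nat \<Rightarrow> real"
    have "(\<Prod>i\<in>{1..n}. ?g i (\<omega> i)) = (\<Prod>i\<in>{1..n}. if i = j then ennreal (exp (\<kappa> * \<omega> j - \<kappa>\<^sup>2 / 2)) else 1)"
      by (intro prod.cong) (auto simp: spike_def)
    then show "(\<Prod>i\<in>{1..n}. ?g i (\<omega> i)) = ennreal (exp (\<kappa> * \<omega> j - \<kappa>\<^sup>2 / 2))"
      using assms by simp
  qed
  finally show ?thesis by (simp add: gaussian_series_def)
qed

text \<open>The likelihood ratio of the Gaussian with mean \<open>\<kappa>\<close> against the
  standard one, minus its expectation 1 under the latter.\<close>

definition centred_ratio :: "real \<Rightarrow> real \<Rightarrow> real" where
  "centred_ratio \<kappa> x = exp (\<kappa> * x - \<kappa>\<^sup>2 / 2) - 1"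

lemma centred_ratio_measurable [measurable]: "centred_ratio \<kappa> \<in> borel_measurable borel"
  unfolding centred_ratio_def by measurable

lemma centred_ratio_mean: "has_bochner_integral (gaussian 0) (centred_ratio \<kappa>) 0"
proof -
  interpret prob_space "gaussian 0" by (rule prob_space_gaussian)
  have "has_bochner_integral (gaussian 0) (\<lambda>x. exp (- \<kappa>\<^sup>2 / 2) * exp (\<kappa> * x) - 1)
      (exp (- \<kappa>\<^sup>2 / 2) * exp (\<kappa>\<^sup>2 / 2) - 1)"
    by (intro has_bochner_integral_diff has_bochner_integral_mult_right gaussian_exp_moment)
       (simp add: has_bochner_integral_iff prob_space[simplified])
  then show ?thesis by (simp add: centred_ratio_def[abs_def] mult_exp_exp algebra_simps)
qed

text \<open>With L the likelihood ratio, (L - 1)^2 = L^2 - 2 (L - 1) - 1, and L^2 is again an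
  exponential whose expectation is exp(\<open>\<kappa>\<^sup>2\<close>). The value is the chi-square
  divergence of the two Gaussians.\<close>

lemma centred_ratio_square:
  "has_bochner_integral (gaussian 0) (\<lambda>x. centred_ratio \<kappa> x * centred_ratio \<kappa> x) (exp (\<kappa>\<^sup>2) - 1)"
proof -
  interpret prob_space "gaussian 0" by (rule prob_space_gaussian)
  have "has_bochner_integral (gaussian 0)
      (\<lambda>x. exp (- \<kappa>\<^sup>2) * exp (2 * \<kappa> * x) - 2 * centred_ratio \<kappa> x - 1)
      (exp (- \<kappa>\<^sup>2) * exp ((2 * \<kappa>)\<^sup>2 / 2) - 2 * 0 - 1)"
    by (intro has_bochner_integral_diff has_bochner_integral_mult_right gaussian_exp_moment centred_ratio_mean)
       (simp_all add: has_bochner_integral_iff prob_space[simplified])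
  moreover have "exp (- \<kappa>\<^sup>2) * exp ((2 * \<kappa>)\<^sup>2 / 2) = exp (\<kappa>\<^sup>2)"
    by (simp add: mult_exp_exp power2_eq_square)
  moreover have "exp (- \<kappa>\<^sup>2) * exp (2 * \<kappa> * x) - 2 * centred_ratio \<kappa> x - 1 = centred_ratio \<kappa> x * centred_ratio \<kappa> x" for x
  proof -
    have "exp (- \<kappa>\<^sup>2) * exp (2 * \<kappa> * x) = exp (\<kappa> * x - \<kappa>\<^sup>2 / 2) * exp (\<kappa> * x - \<kappa>\<^sup>2 / 2)"
      by (simp add: mult_exp_exp algebra_simps)
    then show ?thesis by (simp add: centred_ratio_def algebra_simps)
  qed
  ultimately show ?thesis by simp
qed

lemma has_bochner_integral_PiM_prod:
  fixes h :: "'i \<Rightarrow> 'a \<Rightarrow> real"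
  assumes "product_sigma_finite M" "finite I" "\<And>i. i \<in> I \<Longrightarrow> has_bochner_integral (M i) (h i) (e i)"
  shows "has_bochner_integral (Pi\<^sub>M I M) (\<lambda>\<omega>. \<Prod>i\<in>I. h i (\<omega> i)) (\<Prod>i\<in>I. e i)"
proof -
  interpret product_sigma_finite M by fact
  show ?thesis
    using assms product_integrable_prod[of I h] product_integral_prod[of I h]
    by (simp add: has_bochner_integral_iff)
qed

text \<open>For distinct positions the two ratios are independent with mean 0; for equal positions
  this is the variance.\<close>

lemma centred_ratio_covariance:
  assumes jk: "j \<in> {1..n}" "k \<in> {1..n}"
  shows "has_bochner_integral (gaussian_series n (\<lambda>_. 0))
    (\<lambda>\<omega>. centred_ratio \<kappa> (\<omega> j) * centred_ratio \<kappa> (\<omega> k)) (if j = k then exp (\<kappa>\<^sup>2) - 1 else 0)"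
proof -
  interpret G: prob_space "gaussian 0" by (rule prob_space_gaussian)
  have psf: "product_sigma_finite (\<lambda>i::nat. gaussian 0)" by unfold_locales
  \<comment> \<open>Writing the integrand as a product over all coordinates, with 1 as default
    factor, treats both cases at once: for \<open>j = k\<close> the two factors meet and give the
    square.\<close>
  let ?h = "\<lambda>i x. (if i = j then centred_ratio \<kappa> x else 1) * (if i = k then centred_ratio \<kappa> x else 1)"
  let ?e = "\<lambda>i. if j = k then (if i = j then exp (\<kappa>\<^sup>2) - 1 else 1) else (if i = j \<or> i = k then 0 else 1)"
  have one: "has_bochner_integral (gaussian 0) (\<lambda>_. 1 :: real) 1"
    by (simp add: has_bochner_integral_iff G.prob_space[simplified])
  have "has_bochner_integral (gaussian_series n (\<lambda>_. 0)) (\<lambda>\<omega>. \<Prod>i\<in>{1..n}. ?h i (\<omega> i)) (\<Prod>i\<in>{1..n}. ?e i)"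
    unfolding gaussian_series_def
    by (intro has_bochner_integral_PiM_prod psf finite_atLeastAtMost)
       (auto simp: centred_ratio_mean centred_ratio_square one)
  moreover have "(\<Prod>i\<in>{1..n}. ?h i (\<omega> i)) = centred_ratio \<kappa> (\<omega> j) * centred_ratio \<kappa> (\<omega> k)" for \<omega> :: "nat \<Rightarrow> real"
    using jk by (simp add: prod.distrib prod.delta)
  moreover have "(\<Prod>i\<in>{1..n}. ?e i) = (if j = k then exp (\<kappa>\<^sup>2) - 1 else 0)"
    using jk by (auto simp: prod.delta)
  ultimately show ?thesis by simp
qed

text \<open>The cross terms vanish, so the second moment grows only linearly in
  \<open>card C\<close>; after averaging over \<open>C\<close> it decays like 1 /
  \<open>card C\<close>.\<close>

lemma centred_ratio_sum_square:
  assumes "C \<subseteq> {1..n}"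
  shows "has_bochner_integral (gaussian_series n (\<lambda>_. 0))
    (\<lambda>\<omega>. (\<Sum>j\<in>C. centred_ratio \<kappa> (\<omega> j))\<^sup>2) (real (card C) * (exp (\<kappa>\<^sup>2) - 1))"
proof -
  have fin: "finite C" using assms finite_subset by blast
  have "has_bochner_integral (gaussian_series n (\<lambda>_. 0))
      (\<lambda>\<omega>. \<Sum>j\<in>C. \<Sum>k\<in>C. centred_ratio \<kappa> (\<omega> j) * centred_ratio \<kappa> (\<omega> k))
      (\<Sum>j\<in>C. \<Sum>k\<in>C. if j = k then exp (\<kappa>\<^sup>2) - 1 else 0)"
    using assms by (intro has_bochner_integral_sum centred_ratio_covariance) auto
  then show ?thesis using fin by (simp add: power2_eq_square sum_product)
qed

section \<open>From pure noise to a single spike\<close>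

text \<open>
  The pointwise bound below is \<open>x \<ge> - (1 / 12 + 3 * x\<^sup>2)\<close>, applied to the average of the centred
  likelihood ratios; it replaces the total variation distance by a variance.
\<close>

lemma spike_average:
  assumes C: "C \<subseteq> {1..n}" "C \<noteq> {}"
    and large: "36 * (exp (\<kappa>\<^sup>2) - 1) \<le> real (card C)"
    and T [measurable]: "T \<in> sets (\<Pi>\<^sub>M i\<in>{1..n}. (borel :: real measure))"
    and half: "1 / 2 \<le> measure (gaussian_series n (\<lambda>_. 0)) T"
  shows "\<exists>j\<in>C. 1 / 3 \<le> measure (gaussian_series n (spike \<kappa> j)) T"
proof (rule ccontr)
  assume "\<not> ?thesis"
  then have small: "measure (gaussian_series n (spike \<kappa> j)) T < 1 / 3" if "j \<in> C" for j
    using that by force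
  let ?P = "gaussian_series n (\<lambda>_. 0)"
  interpret prob_space ?P by (rule prob_space_gaussian_series)
  have fin: "finite C" using C finite_subset by blast
  define m where "m = real (card C)"
  have m: "0 < m" using C fin by (simp add: m_def card_gt_0_iff)
  let ?D = "\<lambda>\<omega>. (\<Sum>j\<in>C. centred_ratio \<kappa> (\<omega> j)) / m"
  have T' [measurable]: "T \<in> sets ?P" by simp
  have TP: "T \<subseteq> space ?P" using T' by (rule sets.sets_into_space)
  have int: "integrable ?P (\<lambda>\<omega>. centred_ratio \<kappa> (\<omega> j))" if "j \<in> C" for j
  proof -
    have "integrable (distr ?P borel (\<lambda>\<omega>. \<omega> j)) (centred_ratio \<kappa>)"
      using that C centred_ratio_mean[of \<kappa>]
      by (subst distr_gaussian_series_component) (auto simp: has_bochner_integral_iff)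
    then show ?thesis
      using that C by (subst (asm) integrable_distr_eq) auto
  qed
  have indT: "integrable ?P (indicator T :: _ \<Rightarrow> real)" by (simp add: emeasure_eq_measure)
  have intT: "integrable ?P (\<lambda>\<omega>. indicator T \<omega> * centred_ratio \<kappa> (\<omega> j))" if "j \<in> C" for j
    using integrable_mult_indicator[OF T' int[OF that]] by simp
  \<comment> \<open>Change of measure: passing from noise to the spike at \<open>j\<close> changes
    the probability of \<open>T\<close> by the integral of the centred ratio over
    \<open>T\<close>.\<close>
  have prob: "measure (gaussian_series n (spike \<kappa> j)) T =
      prob T + (\<integral>\<omega>. indicator T \<omega> * centred_ratio \<kappa> (\<omega> j) \<partial>?P)" if "j \<in> C" for j
  proof -
    have j: "j \<in> {1..n}" using that C by auto
    note [measurable] = measurable_gaussian_series_component[OF j]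
    have "measure (gaussian_series n (spike \<kappa> j)) T = (\<integral>\<omega>. indicator T \<omega> \<partial>gaussian_series n (spike \<kappa> j))"
      using TP by (simp add: space_gaussian_series Int_absorb2)
    also have "\<dots> = (\<integral>\<omega>. exp (\<kappa> * \<omega> j - \<kappa>\<^sup>2 / 2) * indicator T \<omega> \<partial>?P)"
      unfolding gaussian_series_spike_density[OF j] by (subst integral_density) auto
    also have "\<dots> = (\<integral>\<omega>. indicator T \<omega> + indicator T \<omega> * centred_ratio \<kappa> (\<omega> j) \<partial>?P)"
      by (intro Bochner_Integration.integral_cong) (auto simp: centred_ratio_def algebra_simps)
    also have "\<dots> = prob T + (\<integral>\<omega>. indicator T \<omega> * centred_ratio \<kappa> (\<omega> j) \<partial>?P)"
      using TP intT[OF that] indT by (simp add: Int_absorb2)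
    finally show ?thesis .
  qed
  \<comment> \<open>If all spikes gave \<open>T\<close> probability below 1/3, so would their
    uniform mixture, whose centred likelihood ratio is \<open>?D\<close>.\<close>
  have "(\<Sum>j\<in>C. measure (gaussian_series n (spike \<kappa> j)) T) < (\<Sum>j\<in>C. 1 / 3)"
    using small C fin by (intro sum_strict_mono) auto
  then have "m * prob T + (\<Sum>j\<in>C. \<integral>\<omega>. indicator T \<omega> * centred_ratio \<kappa> (\<omega> j) \<partial>?P) < m / 3"
    by (simp add: prob sum.distrib m_def)
  moreover have "(\<Sum>j\<in>C. \<integral>\<omega>. indicator T \<omega> * centred_ratio \<kappa> (\<omega> j) \<partial>?P) =
      (\<integral>\<omega>. (\<Sum>j\<in>C. indicator T \<omega> * centred_ratio \<kappa> (\<omega> j)) \<partial>?P)"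
    using intT by (simp add: Bochner_Integration.integral_sum)
  moreover have "(\<Sum>j\<in>C. indicator T \<omega> * centred_ratio \<kappa> (\<omega> j)) = m * (indicator T \<omega> * ?D \<omega>)" for \<omega>
    using m by (simp flip: sum_distrib_left)
  then have "(\<integral>\<omega>. (\<Sum>j\<in>C. indicator T \<omega> * centred_ratio \<kappa> (\<omega> j)) \<partial>?P) =
      m * (\<integral>\<omega>. indicator T \<omega> * ?D \<omega> \<partial>?P)"
    by (simp only: integral_mult_right_zero)
  ultimately have "m * (prob T + (\<integral>\<omega>. indicator T \<omega> * ?D \<omega> \<partial>?P)) < m * (1 / 3)"
    by (simp add: algebra_simps)
  then have upper: "prob T + (\<integral>\<omega>. indicator T \<omega> * ?D \<omega> \<partial>?P) < 1 / 3"
    using m by (simp only: mult_less_cancel_left_pos)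
  have D2: "has_bochner_integral ?P (\<lambda>\<omega>. (?D \<omega>)\<^sup>2) (m * (exp (\<kappa>\<^sup>2) - 1) / m\<^sup>2)"
    unfolding power_divide m_def
    by (intro has_bochner_integral_divide_zero centred_ratio_sum_square C)
  have "integrable ?P (\<lambda>\<omega>. (\<Sum>j\<in>C. indicator T \<omega> * centred_ratio \<kappa> (\<omega> j)) / m)"
    using intT by (intro integrable_divide_zero Bochner_Integration.integrable_sum)
  then have intD: "integrable ?P (\<lambda>\<omega>. indicator T \<omega> * ?D \<omega>)"
    by (simp only: sum_distrib_left times_divide_eq_right)
  have "(\<integral>\<omega>. - (1 / 12 + 3 * (?D \<omega>)\<^sup>2) \<partial>?P) \<le> (\<integral>\<omega>. indicator T \<omega> * ?D \<omega> \<partial>?P)"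
  proof (rule integral_mono)
    show "integrable ?P (\<lambda>\<omega>. - (1 / 12 + 3 * (?D \<omega>)\<^sup>2))"
      using D2 by (auto simp: has_bochner_integral_iff)
    show "- (1 / 12 + 3 * (?D \<omega>)\<^sup>2) \<le> indicator T \<omega> * ?D \<omega>" for \<omega>
    proof -
      \<comment> \<open>The difference of the two sides is (6x + 1)^2 / 12. Outside \<open>T\<close>
        the integrand is 0 and the negative lower bound is trivial.\<close>
      have "- (1 / 12 + 3 * x\<^sup>2) \<le> x" for x :: real
        using zero_le_power2[of "6 * x + 1"] by (simp add: power2_eq_square algebra_simps)
      moreover have "- (1 / 12 + 3 * x\<^sup>2) \<le> 0" for x :: real
        using zero_le_power2[of x] by linarith
      ultimately have "- (1 / 12 + 3 * x\<^sup>2) \<le> indicator T \<omega> * x" for x :: real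
        by (cases "\<omega> \<in> T") (metis indicator_simps mult_1_left mult_zero_left)+
      then show ?thesis .
    qed
  qed (fact intD)
  also have "(\<integral>\<omega>. - (1 / 12 + 3 * (?D \<omega>)\<^sup>2) \<partial>?P) = - (1 / 12 + 3 * (m * (exp (\<kappa>\<^sup>2) - 1) / m\<^sup>2))"
  proof -
    have "has_bochner_integral ?P (\<lambda>\<omega>. - (1 / 12 + 3 * (?D \<omega>)\<^sup>2)) (- (1 / 12 + 3 * (m * (exp (\<kappa>\<^sup>2) - 1) / m\<^sup>2)))"
      by (intro has_bochner_integral_minus has_bochner_integral_add has_bochner_integral_mult_right D2)
         (simp add: has_bochner_integral_iff prob_space)
    then show ?thesis by (rule has_bochner_integral_integral_eq)
  qed
  also have "m * (exp (\<kappa>\<^sup>2) - 1) / m\<^sup>2 = (exp (\<kappa>\<^sup>2) - 1) / m"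
    using m by (simp add: power2_eq_square)
  finally have "- (1 / 12 + 3 * ((exp (\<kappa>\<^sup>2) - 1) / m)) \<le> (\<integral>\<omega>. indicator T \<omega> * ?D \<omega> \<partial>?P)" .
  \<comment> \<open>The constant 36 makes the loss at most 1/12 + 3/36 = 1/6, which is exactly the
    gap between 1/2 and 1/3.\<close>
  moreover have "(exp (\<kappa>\<^sup>2) - 1) / m \<le> 1 / 36"
    using large m by (simp add: field_simps m_def)
  ultimately show False using upper half by linarith
qed

section \<open>Separation of distant spikes and the minimax bound\<close>

text \<open>Triangle inequality through a point of \<open>E\<close>: some \<open>x\<close> in
  \<open>E\<close> lies within \<open>r\<close> of \<open>k - 1\<close>, and that \<open>x\<close>
  lies within \<open>r\<close> of \<open>j - 1\<close> or \<open>j\<close>. The two steps use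
  opposite halves of the Hausdorff distance.\<close>

lemma hausdorff_distance_spikes:
  assumes less: "hausdorff_distance E {j - 1, j} < ennreal r" "hausdorff_distance E {k - 1, k} < ennreal r"
    and jk: "1 \<le> k"
  shows "real k - 1 < real j + 2 * r"
proof -
  have r: "0 < r" using less(1) by (metis ennreal_less_zero_iff not_gr_zero not_less_zero)
  have "(SUP y\<in>{k - 1, k}. INF x\<in>E. ennreal \<bar>real x - real y\<bar>) < ennreal r"
    using less(2) by (simp add: hausdorff_distance_def)
  then have "(INF x\<in>E. ennreal \<bar>real x - real (k - 1)\<bar>) < ennreal r"
    by (rule le_less_trans[rotated]) (auto intro: SUP_upper)
  then obtain x where x: "x \<in> E" "ennreal \<bar>real x - real (k - 1)\<bar> < ennreal r"
    by (auto simp: INF_less_iff)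
  have "(SUP x\<in>E. INF y\<in>{j - 1, j}. ennreal \<bar>real x - real y\<bar>) < ennreal r"
    using less(1) by (simp add: hausdorff_distance_def)
  then have "(INF y\<in>{j - 1, j}. ennreal \<bar>real x - real y\<bar>) < ennreal r"
    by (rule le_less_trans[rotated]) (use x in \<open>auto intro: SUP_upper\<close>)
  then obtain y where y: "y \<in> {j - 1, j}" "ennreal \<bar>real x - real y\<bar> < ennreal r"
    unfolding INF_less_iff by blast
  have "\<bar>real x - real (k - 1)\<bar> < r" "\<bar>real x - real y\<bar> < r"
    using x(2) y(2) r by (simp_all add: ennreal_less_iff)
  moreover have "real y \<le> real j" using y(1) by auto
  ultimately show ?thesis using jk by (simp add: of_nat_diff)
qed

lemma minimax_lower_bound:
  fixes n :: nat and c :: real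
  defines "\<kappa> \<equiv> sqrt (c * ln (real n))"
  assumes c: "0 < c" and n: "16 \<le> n"
    and large: "36 * (exp (\<kappa>\<^sup>2) - 1) \<le> real (n div 16)"
    and est: "est \<in> estimators n"
  shows "ennreal (real n / 8) \<le> (SUP P\<in>model_class c n.
    \<integral>\<^sup>+ \<omega>. hausdorff_distance (est \<omega>) (change_points n P) \<partial>P)"
proof -
  \<comment> \<open>The threshold \<open>h\<close> is three times the target \<open>n / 8\<close>,
    to absorb the probability 1/3. The blocks \<open>A\<close> and \<open>B\<close> avoid the
    positions 1 and \<open>n\<close>, where a spike would not have two change points.\<close>
  define m where "m = n div 16"
  have m: "1 \<le> m" "16 * m \<le> n" using n by (auto simp: m_def)
  define h where "h = 3 * real n / 8"
  define A where "A = {2..m + 1}"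
  define B where "B = {n - m..n - 1}"
  let ?\<Omega> = "space (\<Pi>\<^sub>M i\<in>{1..n}. (borel :: real measure))"
  define T where "T C = {\<omega>\<in>?\<Omega>. \<forall>j\<in>C. ennreal h \<le> hausdorff_distance (est \<omega>) {j - 1, j}}" for C
  have T [measurable]: "T C \<in> sets (\<Pi>\<^sub>M i\<in>{1..n}. (borel :: real measure))" for C
  proof -
    have est': "est \<in> measurable (\<Pi>\<^sub>M i\<in>{1..n}. (borel :: real measure)) (count_space (Pow {1..n}))"
      using est by (simp add: estimators_def)
    let ?E = "{E\<in>Pow {1..n}. \<forall>j\<in>C. ennreal h \<le> hausdorff_distance E {j - 1, j}}"
    \<comment> \<open>The estimator takes values in a discrete space, so any condition on its value
      defines a measurable event.\<close>
    have "T C = est -` ?E \<inter> ?\<Omega>"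
      using measurable_space[OF est'] by (auto simp: T_def)
    then show ?thesis using measurable_sets[OF est', of ?E] by auto
  qed
  let ?P = "gaussian_series n (\<lambda>_. 0)"
  interpret prob_space ?P by (rule prob_space_gaussian_series)
  \<comment> \<open>Were the estimate close to a spike in each block, then n - m - 1 < m + 1 + 3n/4;
    with 16m at most n this gives n < 16.\<close>
  have cover: "?\<Omega> \<subseteq> T A \<union> T B"
  proof (rule ccontr)
    assume "\<not> ?thesis"
    then obtain \<omega> where "\<omega> \<in> ?\<Omega>" "\<omega> \<notin> T A" "\<omega> \<notin> T B" by blast
    then obtain j k where jk: "j \<in> A" "k \<in> B"
        and d: "hausdorff_distance (est \<omega>) {j - 1, j} < ennreal h" "hausdorff_distance (est \<omega>) {k - 1, k} < ennreal h"
      unfolding T_def mem_Collect_eq by (meson not_le_imp_less)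
    have k: "1 \<le> k" using jk m by (auto simp: B_def)
    have "j \<le> m + 1" "n \<le> k + m" using jk by (auto simp: A_def B_def)
    then have "real j \<le> real m + 1" "real n \<le> real k + real m" "16 * real m \<le> real n" "16 \<le> real n"
      using m(2) n by linarith+
    with hausdorff_distance_spikes[OF d k] show False by (simp add: h_def)
  qed
  have "1 = prob (space ?P)" by (simp add: prob_space)
  also have "\<dots> \<le> prob (T A \<union> T B)"
    using cover by (intro finite_measure_mono) (auto simp: space_gaussian_series)
  also have "\<dots> \<le> prob (T A) + prob (T B)"
    by (intro measure_Un_le) auto
  finally have "1 / 2 \<le> prob (T A) \<or> 1 / 2 \<le> prob (T B)" by linarith
  moreover have "A \<subseteq> {2..n - 1}" "B \<subseteq> {2..n - 1}" "card A = m" "card B = m"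
    using m by (auto simp: A_def B_def)
  ultimately obtain C where C: "C \<subseteq> {2..n - 1}" "card C = m" "1 / 2 \<le> prob (T C)" by metis
  have "{2..n - 1} \<subseteq> {1..n}" by auto
  with C(1) have "C \<subseteq> {1..n}" by (rule order_trans)
  moreover have "C \<noteq> {}" using C(2) m by auto
  ultimately obtain j where j: "j \<in> C" "1 / 3 \<le> measure (gaussian_series n (spike \<kappa> j)) (T C)"
    using spike_average[of C n \<kappa> "T C", OF _ _ _ T C(3)] large C(2) unfolding m_def by metis
  let ?Q = "gaussian_series n (spike \<kappa> j)"
  interpret Q: prob_space ?Q by (rule prob_space_gaussian_series)
  have "j \<in> {2..n - 1}" using j(1) C(1) by blast
  then have jn: "2 \<le> j" "j < n" using n by auto
  have \<kappa>: "0 < \<kappa>" using c n by (simp add: \<kappa>_def)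
  \<comment> \<open>Markov's inequality for the spike just found: the risk is at least
    \<open>h\<close> times the probability of a distance of at least \<open>h\<close>.\<close>
  have "ennreal (real n / 8) = ennreal h * ennreal (1 / 3)"
    by (simp add: h_def ennreal_mult[symmetric])
  also have "\<dots> \<le> ennreal h * emeasure ?Q (T C)"
    using j by (intro mult_left_mono) (auto simp: Q.emeasure_eq_measure)
  also have "\<dots> = (\<integral>\<^sup>+ \<omega>. ennreal h * indicator (T C) \<omega> \<partial>?Q)"
    by (simp add: nn_integral_cmult_indicator)
  also have "\<dots> \<le> (\<integral>\<^sup>+ \<omega>. hausdorff_distance (est \<omega>) {j - 1, j} \<partial>?Q)"
    using j by (intro nn_integral_mono) (auto simp: T_def indicator_def)
  also have "\<dots> = (\<integral>\<^sup>+ \<omega>. hausdorff_distance (est \<omega>) (change_points n ?Q) \<partial>?Q)"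
    using jn \<kappa> by (simp add: change_points_spike)
  also have "\<dots> \<le> (SUP P\<in>model_class c n. \<integral>\<^sup>+ \<omega>. hausdorff_distance (est \<omega>) (change_points n P) \<partial>P)"
    using gaussian_series_spike_in_model_class[OF jn c] n unfolding \<kappa>_def by (intro SUP_upper) simp
  finally show ?thesis .
qed

theorem lemma1:
  fixes c :: real
  assumes "0 < c" and "c < 1"
  shows "\<exists>N :: nat. \<forall>n > N.
    (INF est\<in>estimators n. SUP P\<in>model_class c n.
       \<integral>\<^sup>+ \<omega>. hausdorff_distance (est \<omega>) (change_points n P) \<partial>P) \<ge> ennreal (real n / 8)"
proof -
  \<comment> \<open>Here \<open>real n powr c\<close> is exp(\<open>\<kappa>\<^sup>2\<close>), and
    it is of smaller order than \<open>n\<close> because \<open>c < 1\<close>. The bound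
    \<open>n / 16 - 1\<close> stands in for \<open>n div 16\<close> to keep the asymptotics free of
    integer division.\<close>
  have "eventually (\<lambda>n. 36 * (real n powr c - 1) \<le> real n / 16 - 1) sequentially"
    using assms by real_asymp
  then obtain N where N: "\<And>n. N \<le> n \<Longrightarrow> 36 * (real n powr c - 1) \<le> real n / 16 - 1"
    by (auto simp: eventually_sequentially)
  show ?thesis
  proof (intro exI[of _ "max N 16"] allI impI INF_greatest)
    fix n est assume "max N 16 < n" and est: "est \<in> estimators n"
    then have n: "N \<le> n" "16 \<le> n" by auto
    have "exp ((sqrt (c * ln (real n)))\<^sup>2) = real n powr c"
      using n assms by (simp add: powr_def)
    moreover have "real n / 16 - 1 \<le> real (n div 16)"
      by linarith
    ultimately have "36 * (exp ((sqrt (c * ln (real n)))\<^sup>2) - 1) \<le> real (n div 16)"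
      using N[OF n(1)] by simp
    then show "ennreal (real n / 8) \<le> (SUP P\<in>model_class c n.
        \<integral>\<^sup>+ \<omega>. hausdorff_distance (est \<omega>) (change_points n P) \<partial>P)"
      using minimax_lower_bound[OF assms(1) n(2)] est by simp
  qed
qed

end
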